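(* Let $p$ be a prime, let $N$ be a positive integer, and let $\lambda$ and $\mu$ be partitions of $N$. Assume that there exists $m\in\{1,2,\ldots,N-1\}$ such that $$s_t(\lambda)=s_t(\mu)\quad (t=1,2,\ldots,m-1),\qquad s_m(\lambda)<s_m(\mu).$$ Then $$\mathrm{N}(\mathrm{P}(G_{\lambda}))<\mathrm{N}(\mathrm{P}(G_{\mu})).$$
   Context: For a finite group $G$, take independent commuting variables $x_g$ ($g\in G$) and let $M(G):=(x_{gh^{-1}})_{g,h\in G}$ be the group matrix. The group permanent is $\mathrm{P}(G):=\mathrm{perm}(M(G))=\sum_{\sigma}\prod_{g\in G}x_{g\sigma(g)^{-1}}\in\mathbb{Z}[x_g : g\in G]$, where $\sigma$ runs over all permutations of the set $G$. For a polynomial $f$, $\mathrm{N}(f)$ denotes the number of distinct monomials with nonzero coefficient in $f$. A partition of $N$ is $\lambda=(k_1,k_2,\ldots,k_r)$ with $k_1\ge k_2\ge\cdots\ge k_r\ge 1$ and $\sum_i k_i=N$. The associated abelian $p$-group is $G_{\lambda}:=\mathrm{C}_{p^{k_1}}\times\mathrm{C}_{p^{k_2}}\times\cdots\times\mathrm{C}_{p^{k_r}}$ (of order $p^N$), where $\mathrm{C}_n$ is the cyclic group of order $n$. Put $s_0(\lambda):=0$ and $s_t(\lambda):=\sum_{i=1}^{r}\min(k_i,t)$ for $t=1,\ldots,N$ (the number of boxes in the first $t$ columns of the Young diagram of $\lambda$). *)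

theory Defs
  imports
    "HOL-Algebra.Product_Groups"
    "HOL-Library.Poly_Mapping"
    "HOL-Combinatorics.Permutations"
    "HOL-Computational_Algebra.Primes"
begin

text \<open>
  A polynomial with integer coefficients in commuting variables indexed by the type \<open>'a\<close> is a
  finitely supported map from monomials to coefficients; a monomial is a finitely supported map
  from variables to exponents. The ring operations are those of \<^theory>\<open>HOL-Library.Poly_Mapping\<close>.
\<close>

type_synonym 'a int_mpoly = "('a \<Rightarrow>\<^sub>0 nat) \<Rightarrow>\<^sub>0 int"

definition var :: "'a \<Rightarrow> 'a int_mpoly" where
  "var a = Poly_Mapping.single (Poly_Mapping.single a 1) 1"

definition num_monomials :: "'a int_mpoly \<Rightarrow> nat" where
  "num_monomials f = card (Poly_Mapping.keys f)"

definition permanent :: "'a set \<Rightarrow> ('a \<Rightarrow> 'a \<Rightarrow> 'r::comm_semiring_1) \<Rightarrow> 'r" where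
  "permanent A M = (\<Sum>\<sigma> | \<sigma> permutes A. \<Prod>a\<in>A. M a (\<sigma> a))"

text \<open>The variables that occur are only those indexed by elements of the carrier.\<close>

definition group_matrix :: "('a, 'b) monoid_scheme \<Rightarrow> 'a \<Rightarrow> 'a \<Rightarrow> 'a int_mpoly" where
  "group_matrix G g h = var (g \<otimes>\<^bsub>G\<^esub> inv\<^bsub>G\<^esub> h)"

definition group_permanent :: "('a, 'b) monoid_scheme \<Rightarrow> 'a int_mpoly" where
  "group_permanent G = permanent (carrier G) (group_matrix G)"

definition is_partition_of :: "nat list \<Rightarrow> nat \<Rightarrow> bool" where
  "is_partition_of ks n \<longleftrightarrow>
     sorted_wrt (\<ge>) ks \<and> (\<forall>k\<in>set ks. 1 \<le> k) \<and> sum_list ks = n"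

definition abelian_p_group :: "nat \<Rightarrow> nat list \<Rightarrow> (nat \<Rightarrow> int) monoid" where
  "abelian_p_group p ks =
     product_group {..<length ks} (\<lambda>i. integer_mod_group (p ^ (ks ! i)))"

definition column_sum :: "nat list \<Rightarrow> nat \<Rightarrow> nat" where
  "column_sum ks t = (\<Sum>i<length ks. min (ks ! i) t)"

lemma column_sum_0 [simp]: "column_sum ks 0 = 0"
  by (simp add: column_sum_def)

lemma group_permanent_altdef:
  "group_permanent G =
     (\<Sum>\<sigma> | \<sigma> permutes carrier G. \<Prod>g\<in>carrier G. var (g \<otimes>\<^bsub>G\<^esub> inv\<^bsub>G\<^esub> (\<sigma> g)))"
  by (simp add: group_permanent_def permanent_def group_matrix_def)

lemma group_abelian_p_group: "group (abelian_p_group p ks)"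
  by (simp add: abelian_p_group_def)

lemma order_abelian_p_group:
  assumes "p > 0" and "is_partition_of ks n"
  shows "order (abelian_p_group p ks) = p ^ n"
proof -
  have "order (abelian_p_group p ks) = (\<Prod>i<length ks. p ^ (ks ! i))"
    using assms(1)
    by (simp add: order_def abelian_p_group_def card_PiE carrier_integer_mod_group nat_power_eq)
  also have "\<dots> = p ^ (\<Sum>i<length ks. ks ! i)"
    by (simp add: power_sum)
  also have "(\<Sum>i<length ks. ks ! i) = n"
    using assms(2) by (simp add: is_partition_of_def sum_list_sum_nth atLeast0LessThan)
  finally show ?thesis .
qed

end

theory Submission
  imports Defs "HOL-Algebra.Multiplicative_Group"
begin

text \<open>
  A monomial of the group permanent has degree \<open>n = |G|\<close>, and the product in \<open>G\<close> of its variables,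
  counted with multiplicity, is \<open>\<one>\<close>, since the factors \<open>g \<sigma>(g)\<^sup>-\<^sup>1\<close> multiply to \<open>\<one>\<close> in an abelian
  group. By a theorem of Marshall Hall (\<open>hall_difference_of_bijections\<close>) every such monomial occurs,
  and no cancellation is possible because all coefficients count permutations. So the number of
  monomials is the number of multisets of size \<open>n\<close> in \<open>G\<close> with product \<open>\<one>\<close>
  (\<open>keys_group_permanent\<close>).

  For a \<open>p\<close>-group of order \<open>n = p\<^sup>N\<close> this number is
  \[ \frac1n \sum_{t=0}^{N} (a_t - a_{t-1}) \binom{2p^{N-t}-1}{p^{N-t}}, \]
  where \<open>a\<^sub>t\<close> is the number of solutions of \<open>x\<^bsup>p^t\<^esup> = \<one>\<close> and \<open>a\<^sub>-\<^sub>1 = 0\<close>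
  (\<open>card_monomials_of_value_one\<close>). The usual
  derivation sums over characters: a character of order \<open>d\<close> contributes the coefficient of \<open>X\<^sup>n\<close> in
  \<open>(1 - X\<^sup>d)\<^bsup>-n/d\<^esup>\<close>, and there are \<open>a\<^sub>t - a\<^sub>t\<^sub>-\<^sub>1\<close> characters of order \<open>p\<^sup>t\<close>. Only the sum of all characters of
  order \<open>p\<^sup>t\<close> is needed, and that sum is the function \<open>r\<^sub>t - r\<^sub>t\<^sub>-\<^sub>1\<close> on \<open>G\<close>, where \<open>r\<^sub>t y\<close> is the number of
  solutions of \<open>x\<^bsup>p^t\<^esup> = y\<close>. It shares the one property of a character of order \<open>p\<^sup>t\<close> that determines the
  generating function: averaging it over \<open>y g\<^sup>j\<close> for \<open>g \<in> G\<close> gives back its value at \<open>y\<close> if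
  \<open>p\<^sup>t\<close> divides \<open>j\<close>, and \<open>0\<close> otherwise. Hence integers suffice, and no
  characters have to be constructed.

  For \<open>G\<^sub>\<lambda>\<close> one has \<open>a\<^sub>t = p\<^bsup>s_t(\<lambda>)\<^esup>\<close>. The binomial coefficients decrease so fast with \<open>t\<close>
  (\<open>central_binomial_growth\<close>) that the first index at which \<open>s\<^sub>t(\<lambda>)\<close> and \<open>s\<^sub>t(\<mu>)\<close> differ decides the comparison
  (\<open>weighted_increments_sum_less\<close>); this uses \<open>t \<le> s\<^sub>t \<le> N\<close>.
\<close>

section \<open>Differences of bijections on a finite abelian group\<close>

text \<open>
  The labels in \<open>I\<close> occupy seats \<open>\<phi> i\<close> with distinct targets \<open>\<phi> i \<otimes> b i\<close>, and two seats \<open>u\<close>, \<open>v\<close> are still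
  free. Put \<open>M = u \<otimes> v \<otimes> b l\<close> and draw, for each label \<open>i\<close>, an arrow from its seat to
  \<open>M \<otimes> inv (\<phi> i \<otimes> b i)\<close>. Seats and targets being distinct, each element has at most one outgoing and
  at most one incoming arrow. Moreover the product of the two ends of the arrow of \<open>i\<close> is
  \<open>M \<otimes> inv (b i)\<close>, which does not depend on the direction: reversing an arrow keeps its label but
  exchanges the ends. The label \<open>l\<close> is an arrow from \<open>u\<close> to \<open>v\<close>. It can be added after the path of
  arrows that leads into \<open>v\<close> has been reversed; no arrow leaves \<open>u\<close> or \<open>v\<close>, so this path avoids \<open>u\<close>,
  and everything remains injective.
\<close>

lemma (in comm_group) placement_insert:
  assumes \<phi>: "\<phi> \<in> I \<rightarrow> carrier G" and b: "b \<in> insert l I \<rightarrow> carrier G" and l: "l \<notin> I"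
    and inj: "inj_on \<phi> I" "inj_on (\<lambda>i. \<phi> i \<otimes> b i) I"
    and u: "u \<in> carrier G - \<phi> ` I" and v: "v \<in> carrier G - \<phi> ` I" and uv: "u \<noteq> v"
  shows "\<exists>\<phi>'\<in>insert l I \<rightarrow> carrier G.
           inj_on \<phi>' (insert l I) \<and> inj_on (\<lambda>i. \<phi>' i \<otimes> b i) (insert l I)"
proof -
  define \<psi> where "\<psi> i = \<phi> i \<otimes> b i" for i
  \<comment> \<open>The arrow of \<open>i\<close> goes from \<open>\<phi> i\<close> to \<open>refl (\<psi> i)\<close>, and \<open>D\<close> collects the labels on the path into \<open>v\<close>.\<close>
  define M where "M = u \<otimes> v \<otimes> b l"
  define refl where "refl x = M \<otimes> inv x" for x
  define R where "R = {(i, j). i \<in> I \<and> j \<in> I \<and> refl (\<psi> i) = \<phi> j}"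
  define D where "D = {i \<in> I. \<exists>j\<in>I. (i, j) \<in> R\<^sup>* \<and> refl (\<psi> j) = v}"
  define \<phi>' where "\<phi>' i = (if i = l then u else if i \<in> D then refl (\<psi> i) else \<phi> i)" for i
  have bI: "b i \<in> carrier G" and \<phi>I: "\<phi> i \<in> carrier G" and \<psi>I: "\<psi> i \<in> carrier G" if "i \<in> I" for i
    using that \<phi> b by (auto simp: \<psi>_def)
  have bl: "b l \<in> carrier G" and uv': "u \<in> carrier G" "v \<in> carrier G"
    using b u v by auto
  have M: "M \<in> carrier G"
    using bl uv' by (simp add: M_def)
  have refl_closed: "refl x \<in> carrier G" if "x \<in> carrier G" for x
    using that M by (simp add: refl_def)
  have refl_refl: "refl (refl x) = x" if "x \<in> carrier G" for x
    using that M by (simp add: refl_def inv_mult_group m_assoc[symmetric] m_comm[of M])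
  have refl_inj: "refl x = refl y \<longleftrightarrow> x = y" if "x \<in> carrier G" "y \<in> carrier G" for x y
    using that refl_refl by metis
  \<comment> \<open>A reversed arrow carries the same label.\<close>
  have swap: "refl (\<psi> i) \<otimes> b i = refl (\<phi> i)" if "i \<in> I" for i
    using that M bI[of i] \<phi>I[of i]
    by (simp add: refl_def \<psi>_def inv_mult m_assoc)
  have D: "D \<subseteq> I"
    by (auto simp: D_def)
  have D_base: "i \<in> D" if "i \<in> I" "refl (\<psi> i) = v" for i
    using that by (auto simp: D_def)
  have D_back: "i \<in> D" if "i \<in> I" "j \<in> D" "refl (\<psi> i) = \<phi> j" for i j
    using that by (auto simp: D_def R_def intro: converse_rtrancl_into_rtrancl)
  have D_forw: "refl (\<psi> i) = v \<or> refl (\<psi> i) \<in> \<phi> ` D" if i: "i \<in> D" for i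
  proof -
    obtain j where j: "j \<in> I" "(i, j) \<in> R\<^sup>*" "refl (\<psi> j) = v"
      using i by (auto simp: D_def)
    from j(2) show ?thesis
    proof (cases rule: converse_rtranclE)
      case (step k)
      then have "k \<in> D" "refl (\<psi> i) = \<phi> k"
        using j by (auto simp: D_def R_def)
      then show ?thesis by auto
    qed (use j in auto)
  qed
  have \<psi>': "\<phi>' i \<otimes> b i = (if i = l then refl v else if i \<in> D then refl (\<phi> i) else \<psi> i)"
    if "i \<in> insert l I" for i
  proof (cases "i = l")
    case True
    have "M = u \<otimes> b l \<otimes> v"
      using uv' bl by (simp add: M_def m_ac)
    then have "refl v = u \<otimes> b l"
      using uv' bl by (simp add: refl_def m_assoc)
    then show ?thesis
      using True by (simp add: \<phi>'_def)
  next
    case False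
    then show ?thesis
      using that swap[of i] by (auto simp: \<phi>'_def \<psi>_def)
  qed
  have c1: "\<phi> i = \<phi> j \<longleftrightarrow> i = j" and c2: "\<psi> i = \<psi> j \<longleftrightarrow> i = j"
    if "i \<in> I" "j \<in> I" for i j
    using that inj by (auto simp: \<psi>_def inj_on_def)
  \<comment> \<open>The reversed path and the remaining arrows share neither a start nor an end.\<close>
  have n1: "\<phi> i \<noteq> u" "\<phi> i \<noteq> v" if "i \<in> I" for i
    using that u v by auto
  have n2: "refl (\<psi> i) \<noteq> \<phi> j" if "i \<in> D" "j \<in> I" "j \<notin> D" for i j
    using D_forw[OF that(1)] that n1(2)[of j] c1[of _ j] D by (auto simp: subset_iff)
  have n3: "refl (\<psi> i) \<noteq> u" if "i \<in> D" for i
    using D_forw[OF that] uv u D by auto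
  have n4: "refl (\<phi> i) \<noteq> \<psi> j" if "i \<in> D" "j \<in> I" "j \<notin> D" for i j
    using D_back[of j i] that refl_refl[of "\<phi> i"] \<phi>I[of i] D by auto
  have n5: "\<psi> i \<noteq> refl v" if "i \<in> I" "i \<notin> D" for i
    using D_base[of i] that refl_refl[of v] uv' by auto
  have "\<phi>' \<in> insert l I \<rightarrow> carrier G"
    using \<phi>I \<psi>I uv' refl_closed by (auto simp: \<phi>'_def)
  moreover have "inj_on \<phi>' (insert l I)"
  proof (rule inj_onI)
    fix i j assume ij: "i \<in> insert l I" "j \<in> insert l I" and eq: "\<phi>' i = \<phi>' j"
    then show "i = j"
      using n1[of i] n1[of j] n3[of i] n3[of j] n2[of i j] n2[of j i] c1[of i j] c2[of i j]
        refl_inj[of "\<psi> i" "\<psi> j"] \<psi>I[of i] \<psi>I[of j] D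
      by (auto simp: \<phi>'_def split: if_splits)
  qed
  moreover have "inj_on (\<lambda>i. \<phi>' i \<otimes> b i) (insert l I)"
  proof (rule inj_onI)
    fix i j assume ij: "i \<in> insert l I" "j \<in> insert l I" and eq: "\<phi>' i \<otimes> b i = \<phi>' j \<otimes> b j"
    have rv: "refl (\<phi> k) \<noteq> refl v" if "k \<in> I" for k
      using that n1 refl_inj \<phi>I uv' by auto
    show "i = j"
      using ij eq[unfolded \<psi>'[OF ij(1)] \<psi>'[OF ij(2)]]
        n5[of i] n5[of j] rv[of i] rv[of j] n4[of i j] n4[of j i] c1[of i j] c2[of i j]
        refl_inj[of "\<phi> i" "\<phi> j"] \<phi>I[of i] \<phi>I[of j] D
      by (auto split: if_splits)
  qed
  ultimately show ?thesis by blast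
qed

lemma (in comm_group) partial_placement_exists:
  assumes fin: "finite (carrier G)" and "finite I"
    and "b \<in> I \<rightarrow> carrier G" and "card I < order G"
  shows "\<exists>\<phi>\<in>I \<rightarrow> carrier G. inj_on \<phi> I \<and> inj_on (\<lambda>i. \<phi> i \<otimes> b i) I"
  using assms(2-)
proof (induction I rule: finite_induct)
  case empty
  then show ?case by simp
next
  case (insert l I)
  then obtain \<phi> where \<phi>: "\<phi> \<in> I \<rightarrow> carrier G" "inj_on \<phi> I" "inj_on (\<lambda>i. \<phi> i \<otimes> b i) I"
    by force
  have "card (carrier G - \<phi> ` I) \<ge> 2"
    using insert.hyps insert.prems \<phi> fin
    by (subst card_Diff_subset) (auto simp: card_image order_def)
  then obtain u v where "u \<in> carrier G - \<phi> ` I" "v \<in> carrier G - \<phi> ` I" "u \<noteq> v"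
    by (metis card_2_iff obtain_subset_with_card_n insert_subset)
  then show ?case
    using placement_insert[OF \<phi>(1) _ insert.hyps(2) \<phi>(2,3)] insert.prems by blast
qed

text \<open>
  All labels but one can be placed, by the previous lemma. The hypothesis on the product then forces
  the remaining label to fit: multiplying all seats and multiplying all targets both give the product of the whole
  group.
\<close>

theorem (in comm_group) hall_difference_of_bijections:
  assumes fin: "finite (carrier G)" and I: "finite I" "card I = order G"
    and b: "b \<in> I \<rightarrow> carrier G" and prod: "finprod G b I = \<one>"
  shows "\<exists>\<phi>. bij_betw \<phi> I (carrier G) \<and> bij_betw (\<lambda>i. \<phi> i \<otimes> b i) I (carrier G)"
proof -
  have "order G > 0"
    using fin order_gt_0_iff_finite by blast
  then obtain l where l: "l \<in> I"
    using I by (metis all_not_in_conv card_gt_0_iff)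
  define J where "J = I - {l}"
  have J: "finite J" "l \<notin> J" "I = insert l J" "card J + 1 = order G"
    using I l \<open>order G > 0\<close> by (auto simp: J_def)
  obtain \<phi> where \<phi>: "\<phi> \<in> J \<rightarrow> carrier G" "inj_on \<phi> J" "inj_on (\<lambda>i. \<phi> i \<otimes> b i) J"
    using partial_placement_exists[OF fin J(1), of b] b J by (auto simp: Pi_def)
  define \<psi> where "\<psi> i = \<phi> i \<otimes> b i" for i
  have \<psi>: "\<psi> \<in> J \<rightarrow> carrier G" "inj_on \<psi> J"
    using \<phi> b J unfolding \<psi>_def by (auto simp: Pi_iff)
  \<comment> \<open>\<open>u\<close> is the only free seat and \<open>c\<close> the only free target.\<close>
  have missing: "\<exists>x. carrier G = insert x (f ` J) \<and> x \<in> carrier G \<and> x \<notin> f ` J"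
    if f: "f \<in> J \<rightarrow> carrier G" "inj_on f J" for f
  proof -
    have "card (carrier G - f ` J) = 1"
      using f J fin by (subst card_Diff_subset) (auto simp: card_image order_def)
    then obtain x where "carrier G - f ` J = {x}"
      by (auto simp: card_1_singleton_iff)
    with f show ?thesis by (intro exI[of _ x]) auto
  qed
  obtain u where u: "carrier G = insert u (\<phi> ` J)" "u \<in> carrier G" "u \<notin> \<phi> ` J"
    using missing \<phi> by metis
  obtain c where c: "carrier G = insert c (\<psi> ` J)" "c \<in> carrier G" "c \<notin> \<psi> ` J"
    using missing \<psi> by metis
  have full: "finprod G (\<lambda>x. x) (carrier G) = x \<otimes> finprod G f J"
    if "f \<in> J \<rightarrow> carrier G" "inj_on f J" "carrier G = insert x (f ` J)" "x \<in> carrier G" "x \<notin> f ` J"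
    for f x
  proof -
    have "finprod G (\<lambda>x. x) (carrier G) = finprod G (\<lambda>x. x) (insert x (f ` J))"
      using that(3) by simp
    also have "\<dots> = x \<otimes> finprod G (\<lambda>x. x) (f ` J)"
      using that J by (subst finprod_insert) auto
    also have "finprod G (\<lambda>x. x) (f ` J) = finprod G f J"
      using that by (subst finprod_reindex) auto
    finally show ?thesis .
  qed
  have bl: "b l \<in> carrier G" and bJ: "b \<in> J \<rightarrow> carrier G"
    using b J by auto
  define P Q where "P = finprod G \<phi> J" and "Q = finprod G b J"
  have PQ: "P \<in> carrier G" "Q \<in> carrier G"
    using \<phi> bJ by (auto simp: P_def Q_def)
  have "finprod G \<psi> J = P \<otimes> Q"
    unfolding \<psi>_def P_def Q_def using \<phi> bJ by simp
  then have "u \<otimes> P = c \<otimes> (P \<otimes> Q)"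
    using full[OF \<phi>(1,2) u] full[OF \<psi> c] by (simp add: P_def)
  then have "P \<otimes> u = P \<otimes> (c \<otimes> Q)"
    using PQ u(2) c(2) by (simp add: m_ac)
  then have ucQ: "u = c \<otimes> Q"
    using PQ u(2) c(2) by simp
  have "b l \<otimes> Q = \<one>"
    using prod J bl bJ by (simp add: Q_def)
  moreover have "u \<otimes> b l = c \<otimes> (b l \<otimes> Q)"
    using ucQ PQ bl c(2) by (simp add: m_ac)
  ultimately have target: "u \<otimes> b l = c"
    using c(2) by simp
  define \<phi>' where "\<phi>' = \<phi>(l := u)"
  have "inj_on \<phi>' I" "\<phi>' ` I = carrier G"
    using \<phi> u J by (auto simp: \<phi>'_def inj_on_def)
  moreover have eq: "\<phi>' i \<otimes> b i = (\<psi>(l := c)) i" if "i \<in> I" for i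
    using target by (auto simp: \<phi>'_def \<psi>_def)
  have "inj_on (\<psi>(l := c)) I" "(\<psi>(l := c)) ` I = carrier G"
    using \<psi> c J by (auto simp: inj_on_def)
  then have "inj_on (\<lambda>i. \<phi>' i \<otimes> b i) I" "(\<lambda>i. \<phi>' i \<otimes> b i) ` I = carrier G"
    using eq by (auto simp: inj_on_def)
  ultimately show ?thesis
    by (auto simp: bij_betw_def)
qed

section \<open>Monomials of the group permanent\<close>

definition monomials_of_degree :: "'a set \<Rightarrow> nat \<Rightarrow> ('a \<Rightarrow>\<^sub>0 nat) set" where
  "monomials_of_degree A k = {m. Poly_Mapping.keys m \<subseteq> A \<and> (\<Sum>a\<in>A. Poly_Mapping.lookup m a) = k}"

definition monomial_value :: "('a, 'b) monoid_scheme \<Rightarrow> ('a \<Rightarrow>\<^sub>0 nat) \<Rightarrow> 'a" where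
  "monomial_value G m = finprod G (\<lambda>a. a [^]\<^bsub>G\<^esub> Poly_Mapping.lookup m a) (carrier G)"

abbreviation power_monomial :: "'a \<Rightarrow> nat \<Rightarrow> 'a \<Rightarrow>\<^sub>0 nat" where
  "power_monomial a j \<equiv> Poly_Mapping.single a j"

lemma finite_monomials_of_degree:
  assumes "finite A"
  shows "finite (monomials_of_degree A k)"
proof -
  have "inj_on (\<lambda>m. restrict (Poly_Mapping.lookup m) A) (monomials_of_degree A k)"
  proof (rule inj_onI, rule poly_mapping_eqI)
    fix m m' a
    assume m: "m \<in> monomials_of_degree A k" "m' \<in> monomials_of_degree A k"
      and eq: "restrict (Poly_Mapping.lookup m) A = restrict (Poly_Mapping.lookup m') A"
    show "Poly_Mapping.lookup m a = Poly_Mapping.lookup m' a"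
    proof (cases "a \<in> A")
      case True
      then show ?thesis using eq by (metis restrict_apply')
    next
      case False
      then have "a \<notin> Poly_Mapping.keys m" "a \<notin> Poly_Mapping.keys m'"
        using m by (auto simp: monomials_of_degree_def)
      then show ?thesis by (simp add: in_keys_iff)
    qed
  qed
  moreover have "(\<lambda>m. restrict (Poly_Mapping.lookup m) A) ` monomials_of_degree A k \<subseteq> A \<rightarrow>\<^sub>E {..k}"
  proof -
    have "Poly_Mapping.lookup m a \<le> k" if "m \<in> monomials_of_degree A k" "a \<in> A" for m a
      using that member_le_sum[of a A "Poly_Mapping.lookup m"] assms
      by (auto simp: monomials_of_degree_def)
    then show ?thesis by auto
  qed
  moreover have "finite (A \<rightarrow>\<^sub>E {..k})"
    using assms by (simp add: finite_PiE)
  ultimately show ?thesis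
    by (meson finite_imageD finite_subset)
qed

lemma monomials_of_degree_0:
  assumes "finite A"
  shows "monomials_of_degree A 0 = {0}"
proof -
  have "m = 0" if "Poly_Mapping.keys m \<subseteq> A" "\<forall>a\<in>A. Poly_Mapping.lookup m a = 0" for m
    using that by (intro poly_mapping_eqI) (metis in_keys_iff lookup_zero subsetD)
  then show ?thesis
    using assms by (auto simp: monomials_of_degree_def)
qed

lemma sum_lookup_add_power:
  assumes "finite A" "a \<in> A"
  shows "(\<Sum>x\<in>A. Poly_Mapping.lookup (m + power_monomial a j) x) = (\<Sum>x\<in>A. Poly_Mapping.lookup m x) + j"
  using assms by (simp add: lookup_add sum.distrib lookup_single when_def)

lemma keys_add_nat:
  "Poly_Mapping.keys (m + m' :: 'a \<Rightarrow>\<^sub>0 nat) = Poly_Mapping.keys m \<union> Poly_Mapping.keys m'"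
  by (auto simp: in_keys_iff lookup_add)

text \<open>
  A monomial \<open>m\<close> lies in the right-hand set for exactly \<open>lookup m a\<close> values of \<open>j \<ge> 1\<close>. Summing over
  \<open>j\<close> therefore turns an exponent into a count of monomials of smaller degree.
\<close>

lemma bij_betw_add_power_monomial:
  assumes "finite A" "a \<in> A" "j \<le> k"
  shows "bij_betw (\<lambda>m. m + power_monomial a j) (monomials_of_degree A (k - j))
           {m \<in> monomials_of_degree A k. j \<le> Poly_Mapping.lookup m a}"
proof (rule bij_betw_imageI)
  show "inj_on (\<lambda>m. m + power_monomial a j) (monomials_of_degree A (k - j))"
    by (simp add: inj_on_def)
  have "m + power_monomial a j \<in> monomials_of_degree A k \<and> j \<le> Poly_Mapping.lookup (m + power_monomial a j) a"
    if "m \<in> monomials_of_degree A (k - j)" for m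
    using that assms sum_lookup_add_power[OF assms(1,2), of m j]
    by (auto simp: monomials_of_degree_def keys_add_nat lookup_add split: if_splits)
  moreover have "m \<in> (\<lambda>m. m + power_monomial a j) ` monomials_of_degree A (k - j)"
    if m: "m \<in> monomials_of_degree A k" "j \<le> Poly_Mapping.lookup m a" for m
  proof -
    define m' where "m' = m - power_monomial a j"
    have eq: "m = m' + power_monomial a j"
      using m(2) by (intro poly_mapping_eqI) (auto simp: m'_def lookup_add lookup_minus lookup_single when_def)
    have "m' \<in> monomials_of_degree A (k - j)"
      using m(1) sum_lookup_add_power[OF assms(1,2), of m' j]
      unfolding eq by (auto simp: monomials_of_degree_def keys_add_nat)
    then show ?thesis using eq by blast
  qed
  ultimately show "(\<lambda>m. m + power_monomial a j) ` monomials_of_degree A (k - j) =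
      {m \<in> monomials_of_degree A k. j \<le> Poly_Mapping.lookup m a}"
    by blast
qed

lemma monomial_as_sum_over_labels:
  assumes "finite I" and "m \<in> monomials_of_degree A (card I)" and "finite A"
  shows "\<exists>b\<in>I \<rightarrow> A. m = (\<Sum>i\<in>I. power_monomial (b i) 1)"
  using assms(1,2)
proof (induction I arbitrary: m rule: finite_induct)
  case empty
  then show ?case
    using assms(3) by (simp add: monomials_of_degree_0)
next
  case (insert l I)
  have "(\<Sum>a\<in>A. Poly_Mapping.lookup m a) \<noteq> 0"
    using insert.prems insert.hyps by (simp add: monomials_of_degree_def)
  then have "\<exists>a\<in>A. Poly_Mapping.lookup m a \<noteq> 0"
    by (meson sum.neutral)
  then obtain a where a: "a \<in> A" "1 \<le> Poly_Mapping.lookup m a"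
    by (auto simp: Suc_le_eq)
  then have "m \<in> (\<lambda>m. m + power_monomial a 1) ` monomials_of_degree A (card (insert l I) - 1)"
    using bij_betw_imp_surj_on[OF bij_betw_add_power_monomial[OF assms(3) a(1), of 1 "card (insert l I)"]]
      insert.hyps insert.prems by simp
  then obtain m' where m': "m = m' + power_monomial a 1" "m' \<in> monomials_of_degree A (card I)"
    using insert.hyps by auto
  obtain b where b: "b \<in> I \<rightarrow> A" "m' = (\<Sum>i\<in>I. power_monomial (b i) 1)"
    using insert.IH[OF m'(2)] by blast
  have "(\<Sum>i\<in>I. power_monomial (b i) 1) = (\<Sum>i\<in>I. power_monomial ((b(l := a)) i) (1::nat))"
    using insert.hyps by (intro sum.cong) auto
  then show ?case
    using b m'(1) a insert.hyps by (intro bexI[of _ "b(l := a)"]) (auto simp: add.commute)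
qed

context comm_group
begin

lemma monomial_value_closed [simp, intro]: "monomial_value G m \<in> carrier G"
  by (simp add: monomial_value_def)

lemma monomial_value_0 [simp]: "monomial_value G 0 = \<one>"
  by (simp add: monomial_value_def)

lemma monomial_value_add:
  "monomial_value G (m + m') = monomial_value G m \<otimes> monomial_value G m'"
proof -
  have "monomial_value G (m + m') =
      finprod G (\<lambda>a. a [^] Poly_Mapping.lookup m a \<otimes> a [^] Poly_Mapping.lookup m' a) (carrier G)"
    unfolding monomial_value_def
    by (rule finprod_cong') (auto simp: lookup_add nat_pow_mult)
  then show ?thesis
    by (simp add: monomial_value_def)
qed

lemma monomial_value_power:
  assumes "finite (carrier G)" "a \<in> carrier G"
  shows "monomial_value G (power_monomial a j) = a [^] j"
proof -
  have "monomial_value G (power_monomial a j) = finprod G (\<lambda>x. if a = x then x [^] j else \<one>) (carrier G)"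
    unfolding monomial_value_def by (rule finprod_cong') (auto simp: lookup_single)
  also have "\<dots> = a [^] j"
    using assms by (subst finprod_singleton) auto
  finally show ?thesis .
qed

lemma monomial_value_sum:
  assumes "finite (carrier G)" "finite I" "b \<in> I \<rightarrow> carrier G"
  shows "monomial_value G (\<Sum>i\<in>I. power_monomial (b i) 1) = finprod G b I"
  using assms(2,3)
  by (induction I rule: finite_induct)
    (auto simp: monomial_value_add monomial_value_power assms(1) Pi_iff)

end

lemma prod_var:
  "(\<Prod>i\<in>I. var (f i)) = Poly_Mapping.single (\<Sum>i\<in>I. power_monomial (f i) 1) 1"
  by (induction I rule: infinite_finite_induct) (auto simp: var_def mult_single)

lemma keys_sum_of_monomials:
  assumes "finite S"
  shows "Poly_Mapping.keys (\<Sum>s\<in>S. Poly_Mapping.single (f s) (1::int)) = f ` S"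
proof -
  have "Poly_Mapping.lookup (\<Sum>s\<in>S. Poly_Mapping.single (f s) (1::int)) m = int (card {s\<in>S. f s = m})" for m
    using assms by (simp add: lookup_sum lookup_single when_def sum.If_cases Int_def eq_commute)
  then show ?thesis
    using assms by (auto simp: in_keys_iff card_eq_0_iff)
qed

text \<open>
  One inclusion holds since \<open>\<Prod>g \<sigma>(g)\<^sup>-\<^sup>1 = \<one>\<close>. For the other, list the variables of the monomial as
  \<open>b\<close>, indexed by the group itself, and take bijections \<open>\<phi>\<close> and \<open>\<psi> = \<phi> \<otimes> b\<close>. Then \<open>\<sigma> = \<phi> \<circ> \<psi>\<^sup>-\<^sup>1\<close> has
  the entry \<open>\<psi> i \<otimes> inv (\<phi> i) = b i\<close> in row \<open>\<psi> i\<close>.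
\<close>

theorem (in comm_group) keys_group_permanent:
  assumes fin: "finite (carrier G)"
  shows "Poly_Mapping.keys (group_permanent G) =
           {m \<in> monomials_of_degree (carrier G) (order G). monomial_value G m = \<one>}"
proof -
  let ?mon = "\<lambda>\<sigma>. \<Sum>g\<in>carrier G. power_monomial (g \<otimes> inv (\<sigma> g)) (1::nat)"
  have "Poly_Mapping.keys (group_permanent G) = ?mon ` {\<sigma>. \<sigma> permutes carrier G}"
    using fin by (simp add: group_permanent_altdef prod_var keys_sum_of_monomials finite_permutations)
  also have "\<dots> = {m \<in> monomials_of_degree (carrier G) (order G). monomial_value G m = \<one>}"
  proof (intro equalityI subsetI)
    fix m assume "m \<in> ?mon ` {\<sigma>. \<sigma> permutes carrier G}"
    then obtain \<sigma> where \<sigma>: "\<sigma> permutes carrier G" and m: "m = ?mon \<sigma>"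
      by auto
    have closed: "\<sigma> g \<in> carrier G" if "g \<in> carrier G" for g
      using \<sigma> that by (simp add: permutes_in_image)
    have "Poly_Mapping.keys m \<subseteq> carrier G"
      unfolding m using closed by (intro order.trans[OF Poly_Mapping.keys_sum]) auto
    moreover have "(\<Sum>a\<in>carrier G. Poly_Mapping.lookup m a) = order G"
    proof -
      have "(\<Sum>a\<in>carrier G. Poly_Mapping.lookup m a) =
          (\<Sum>g\<in>carrier G. \<Sum>a\<in>carrier G. Poly_Mapping.lookup (power_monomial (g \<otimes> inv (\<sigma> g)) 1) a)"
        unfolding m lookup_sum by (rule sum.swap)
      also have "\<dots> = (\<Sum>g\<in>carrier G. 1)"
        using fin closed by (intro sum.cong) (auto simp: lookup_single when_def)
      finally show ?thesis by (simp add: order_def)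
    qed
    moreover have "monomial_value G m = \<one>"
    proof -
      have "monomial_value G m = finprod G (\<lambda>g. g \<otimes> inv (\<sigma> g)) (carrier G)"
        unfolding m using fin closed by (subst monomial_value_sum) auto
      also have "\<dots> = finprod G (\<lambda>g. g) (carrier G) \<otimes> finprod G (\<lambda>g. inv (\<sigma> g)) (carrier G)"
        using closed by (subst finprod_multf) auto
      also have "finprod G (\<lambda>g. inv (\<sigma> g)) (carrier G) = finprod G (\<lambda>g. inv g) (\<sigma> ` carrier G)"
        using \<sigma> by (subst finprod_reindex) (auto simp: permutes_image permutes_inj_on)
      also have "\<sigma> ` carrier G = carrier G"
        using \<sigma> by (rule permutes_image)
      also have "finprod G (\<lambda>g. g) (carrier G) \<otimes> finprod G (\<lambda>g. inv g) (carrier G) =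
          finprod G (\<lambda>g. g \<otimes> inv g) (carrier G)"
        by (subst finprod_multf) auto
      also have "\<dots> = \<one>"
        by (rule finprod_one_eqI) simp
      finally show ?thesis .
    qed
    ultimately show "m \<in> {m \<in> monomials_of_degree (carrier G) (order G). monomial_value G m = \<one>}"
      by (simp add: monomials_of_degree_def)
  next
    fix m assume m: "m \<in> {m \<in> monomials_of_degree (carrier G) (order G). monomial_value G m = \<one>}"
    obtain b where b: "b \<in> carrier G \<rightarrow> carrier G" "m = (\<Sum>i\<in>carrier G. power_monomial (b i) 1)"
      using monomial_as_sum_over_labels[of "carrier G" m "carrier G"] m fin by (auto simp: order_def)
    have "finprod G b (carrier G) = \<one>"
      using m b(2) monomial_value_sum[OF fin fin b(1)] by simp
    then obtain \<phi> where \<phi>: "bij_betw \<phi> (carrier G) (carrier G)"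
      "bij_betw (\<lambda>i. \<phi> i \<otimes> b i) (carrier G) (carrier G)"
      using hall_difference_of_bijections[OF fin fin _ b(1)] by (auto simp: order_def)
    define \<psi> where "\<psi> i = \<phi> i \<otimes> b i" for i
    have \<psi>: "bij_betw \<psi> (carrier G) (carrier G)"
      using \<phi>(2) by (simp add: \<psi>_def[abs_def])
    define \<sigma> where "\<sigma> g = (if g \<in> carrier G then \<phi> (inv_into (carrier G) \<psi> g) else g)" for g
    have "bij_betw \<sigma> (carrier G) (carrier G)"
      using bij_betw_trans[OF bij_betw_inv_into[OF \<psi>] \<phi>(1)]
      by (subst bij_betw_cong[where g = "\<phi> \<circ> inv_into (carrier G) \<psi>"]) (auto simp: \<sigma>_def)
    then have "\<sigma> permutes carrier G"
      by (intro bij_imp_permutes) (auto simp: \<sigma>_def)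
    moreover have "m = ?mon \<sigma>"
    proof -
      have "?mon \<sigma> = (\<Sum>i\<in>carrier G. power_monomial (\<psi> i \<otimes> inv (\<sigma> (\<psi> i))) 1)"
        by (rule sum.reindex_bij_betw[OF \<psi>, symmetric])
      also have "\<dots> = (\<Sum>i\<in>carrier G. power_monomial (b i) 1)"
      proof (rule sum.cong)
        fix i assume i: "i \<in> carrier G"
        then have "b i \<in> carrier G" "\<phi> i \<in> carrier G" "\<psi> i \<in> carrier G"
          using b \<phi>(1) \<psi> by (auto simp: bij_betw_def)
        moreover have "\<sigma> (\<psi> i) = \<phi> i"
          using i \<psi> \<open>\<psi> i \<in> carrier G\<close> by (simp add: \<sigma>_def bij_betw_inv_into_left)
        ultimately have "\<psi> i \<otimes> inv (\<sigma> (\<psi> i)) = b i"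
          by (simp add: \<psi>_def m_comm[of "\<phi> i"] m_assoc)
        then show "power_monomial (\<psi> i \<otimes> inv (\<sigma> (\<psi> i))) 1 = power_monomial (b i) 1"
          by simp
      qed simp
      finally show ?thesis
        using b(2) by simp
    qed
    ultimately show "m \<in> ?mon ` {\<sigma>. \<sigma> permutes carrier G}"
      by blast
  qed
  finally show ?thesis .
qed

section \<open>Counting roots in a finite abelian group\<close>

definition root_count :: "('a, 'b) monoid_scheme \<Rightarrow> nat \<Rightarrow> 'a \<Rightarrow> nat" where
  "root_count G d y = card {h \<in> carrier G. h [^]\<^bsub>G\<^esub> d = y}"

text \<open>
  Both sides count pairs: the left one pairs \<open>(h, g)\<close> with \<open>h\<^sup>d \<otimes> g\<^sup>-\<^sup>j = y\<close>. Write \<open>e = gcd d j\<close>, \<open>d = e d'\<close>,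
  \<open>j = e j'\<close>. As \<open>d'\<close> and \<open>j'\<close> are coprime, \<open>x = h\<^bsup>d'\<^esup> \<otimes> g\<^bsup>-j'\<^esup>\<close> is the first coordinate of a unimodular
  change of variables on \<open>G \<times> G\<close>, and the condition becomes \<open>x\<^sup>e = y\<close> with the second coordinate
  arbitrary.
\<close>

lemma (in comm_group) sum_root_count:
  assumes fin: "finite (carrier G)" and y: "y \<in> carrier G" and d: "d > 0"
  shows "(\<Sum>g\<in>carrier G. root_count G d (y \<otimes> g [^] j)) = order G * root_count G (gcd d j) y"
proof -
  let ?C = "carrier G"
  define e where "e = gcd d j"
  obtain d' j' where d': "d = e * d'" and j': "j = e * j'"
    unfolding e_def by (metis dvdE gcd_dvd1 gcd_dvd2)
  obtain s r where "d * s = j * r + e"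
    using bezout_nat[of d j] d by (auto simp: e_def)
  then have "e * (d' * s) = e * (j' * r + 1)"
    by (simp add: d' j' algebra_simps)
  then have det: "d' * s = j' * r + 1"
    using d d' by (metis mult_cancel_left mult_zero_left nat_less_le)
  \<comment> \<open>\<open>T\<close> has the exponent matrix with rows \<open>(d', -j')\<close> and \<open>(-r, s)\<close>, of determinant 1,
      and \<open>U\<close> is its inverse.\<close>
  define T where "T = (\<lambda>(h, g). (h [^] d' \<otimes> inv (g [^] j'), inv (h [^] r) \<otimes> g [^] s))"
  define U where "U = (\<lambda>(x, w). (x [^] s \<otimes> w [^] j', x [^] r \<otimes> w [^] d'))"
  have cancel: "X \<otimes> x \<otimes> inv Y \<otimes> (inv X \<otimes> Y) = x" "X \<otimes> inv Y \<otimes> (inv X \<otimes> (Y \<otimes> x)) = x"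
    if "X \<in> ?C" "Y \<in> ?C" "x \<in> ?C" for X Y x
  proof -
    have "X \<otimes> x \<otimes> Y' \<otimes> (X' \<otimes> Y) = X \<otimes> X' \<otimes> (Y \<otimes> Y') \<otimes> x"
      "X \<otimes> Y' \<otimes> (X' \<otimes> (Y \<otimes> x)) = X \<otimes> X' \<otimes> (Y \<otimes> Y') \<otimes> x"
      if "X' \<in> ?C" "Y' \<in> ?C" for X' Y'
      using that \<open>X \<in> ?C\<close> \<open>Y \<in> ?C\<close> \<open>x \<in> ?C\<close> by (simp_all add: m_ac)
    from this[of "inv X" "inv Y"] show "X \<otimes> x \<otimes> inv Y \<otimes> (inv X \<otimes> Y) = x"
      "X \<otimes> inv Y \<otimes> (inv X \<otimes> (Y \<otimes> x)) = x"
      using that by simp_all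
  qed
  have pow_x: "(h [^] d' \<otimes> inv (g [^] j')) [^] i = h [^] (d' * i) \<otimes> inv (g [^] (j' * i))"
    and pow_w: "(inv (h [^] r) \<otimes> g [^] s) [^] i = inv (h [^] (r * i)) \<otimes> g [^] (s * i)"
    if "h \<in> ?C" "g \<in> ?C" for h g and i :: nat
    using that by (simp_all add: nat_pow_distrib nat_pow_inv nat_pow_pow)
  have UT: "U (T (h, g)) = (h, g)" if "h \<in> ?C" "g \<in> ?C" for h g
  proof -
    have "d' * s = r * j' + 1" "s * d' = j' * r + 1"
      using det by (simp_all add: mult.commute)
    then have pows: "h [^] (d' * s) = h [^] (r * j') \<otimes> h" "g [^] (s * d') = g [^] (j' * r) \<otimes> g"
      by simp_all
    show ?thesis
      using that cancel(1)[of "h [^] (r * j')" "g [^] (j' * s)" h]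
        cancel(2)[of "h [^] (d' * r)" "g [^] (j' * r)" g]
      by (simp add: T_def U_def pow_x pow_w pows mult.commute[of s j'] mult.commute[of r d'])
  qed
  have "inj_on T (?C \<times> ?C)"
    by (rule inj_on_inverseI[of _ U]) (use UT in auto)
  moreover have "T ` (?C \<times> ?C) \<subseteq> ?C \<times> ?C"
    by (auto simp: T_def)
  ultimately have bij: "bij_betw T (?C \<times> ?C) (?C \<times> ?C)"
    using fin by (simp add: bij_betw_def endo_inj_surj)
  define P where "P q \<longleftrightarrow> fst (T q) [^] e = y" for q
  have P: "h [^] d = y \<otimes> g [^] j \<longleftrightarrow> P (h, g)" if "h \<in> ?C" "g \<in> ?C" for h g
  proof -
    have "fst (T (h, g)) [^] e = h [^] d \<otimes> inv (g [^] j)"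
      using that by (simp add: T_def pow_x d' j' mult.commute)
    then show ?thesis
      using that y unfolding P_def by (metis inv_solve_right' nat_pow_closed)
  qed
  have "(\<Sum>g\<in>?C. root_count G d (y \<otimes> g [^] j)) =
      card (SIGMA g:?C. {h \<in> ?C. h [^] d = y \<otimes> g [^] j})"
    using fin by (simp add: root_count_def)
  also have "\<dots> = card {q \<in> ?C \<times> ?C. P q}"
    by (rule bij_betw_same_card[of prod.swap]) (auto simp: bij_betw_def inj_on_def P)
  also have "\<dots> = card {q \<in> ?C \<times> ?C. fst q [^] e = y}"
  proof (rule bij_betw_same_card[of T])
    have "T ` {q \<in> ?C \<times> ?C. P q} = {q \<in> T ` (?C \<times> ?C). fst q [^] e = y}"
      unfolding P_def by blast
    then show "bij_betw T {q \<in> ?C \<times> ?C. P q} {q \<in> ?C \<times> ?C. fst q [^] e = y}"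
      using bij by (auto simp: bij_betw_def inj_on_def)
  qed
  also have "{q \<in> ?C \<times> ?C. fst q [^] e = y} = {h \<in> ?C. h [^] e = y} \<times> ?C"
    by auto
  finally show ?thesis
    by (simp add: card_cartesian_product root_count_def order_def e_def)
qed

section \<open>Counting monomials of value one\<close>

text \<open>
  For \<open>d > 0\<close>, the coefficient of \<open>X\<^sup>k\<close> in the power series \<open>(1 - X\<^sup>d)\<^bsup>-q\<^esup>\<close>.
\<close>

definition inverse_power_coeff :: "nat \<Rightarrow> nat \<Rightarrow> nat \<Rightarrow> nat" where
  "inverse_power_coeff d q k = (if d dvd k then (k div d + q - 1) choose (k div d) else 0)"

text \<open>
  This is \<open>X F' = d q (X\<^sup>d + X\<^bsup>2d\<^esup> + \<dots>) F\<close> for \<open>F = (1 - X\<^sup>d)\<^bsup>-q\<^esup>\<close>, read off coefficientwise. It reduces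
  to the parallel summation \<open>sum_choose_lower\<close> and the absorption \<open>Suc_times_binomial_add\<close>.
\<close>

lemma inverse_power_coeff_rec:
  assumes d: "d > 0" and q: "q > 0"
  shows "k * inverse_power_coeff d q k =
           d * q * (\<Sum>j\<in>{1..k}. if d dvd j then inverse_power_coeff d q (k - j) else 0)"
proof (cases "d dvd k")
  case False
  then have "(if d dvd j then inverse_power_coeff d q (k - j) else 0) = 0" if "j \<in> {1..k}" for j
    using that by (auto simp: inverse_power_coeff_def dvd_diff_nat dest: dvd_diffD)
  then show ?thesis
    using False by (simp add: inverse_power_coeff_def)
next
  case True
  then obtain l where l: "k = d * l" by blast
  have "(\<Sum>j\<in>{1..k}. if d dvd j then inverse_power_coeff d q (k - j) else 0) =
      (\<Sum>j\<in>{j\<in>{1..k}. d dvd j}. inverse_power_coeff d q (k - j))"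
    by (rule sum.inter_filter[symmetric]) simp
  also have "{j\<in>{1..k}. d dvd j} = (*) d ` {1..l}"
    using d by (auto simp: l Suc_le_eq)
  also have "(\<Sum>j\<in>(*) d ` {1..l}. inverse_power_coeff d q (k - j)) =
      (\<Sum>i\<in>{1..l}. inverse_power_coeff d q (d * (l - i)))"
    using d by (subst sum.reindex) (auto simp: inj_on_def l right_diff_distrib')
  also have "\<dots> = (\<Sum>i\<in>{1..l}. (l - i + q - 1) choose (l - i))"
    using d by (simp add: inverse_power_coeff_def)
  also have "\<dots> = (\<Sum>i<l. (i + q - 1) choose i)"
    by (rule sum.reindex_bij_witness[of _ "\<lambda>i. l - i" "\<lambda>i. l - i"]) auto
  finally have sum: "(\<Sum>j\<in>{1..k}. if d dvd j then inverse_power_coeff d q (k - j) else 0) =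
      (\<Sum>i<l. (i + q - 1) choose i)" .
  show ?thesis
  proof (cases l)
    case 0
    then show ?thesis by (simp add: l)
  next
    case (Suc l')
    obtain q' where q': "q = Suc q'"
      using q gr0_implies_Suc by blast
    have "(\<Sum>i<l. (i + q - 1) choose i) = Suc (l' + q') choose l'"
      using sum_choose_lower[of q' l'] by (simp add: Suc q' lessThan_Suc_atMost add.commute)
    moreover have "l * ((l + q - 1) choose l) = q * (Suc (l' + q') choose l')"
      using Suc_times_binomial_add[of l' q'] by (simp add: Suc q')
    ultimately show ?thesis
      unfolding sum using d by (simp add: inverse_power_coeff_def l)
  qed
qed

text \<open>
  Newton's identity between complete homogeneous functions and power sums, with a function \<open>F\<close> on
  the group in place of a character. As \<open>k\<close> is the sum of the exponents of \<open>m\<close>, the left side runs over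
  triples \<open>(m, g, j)\<close> such that \<open>g\<^sup>j\<close> divides \<open>m\<close>, and \<open>g\<^sup>j\<close> can be split off.
\<close>

lemma (in comm_group) sum_over_monomials_rec:
  fixes F :: "'a \<Rightarrow> int"
  assumes fin: "finite (carrier G)"
  shows "int k * (\<Sum>m\<in>monomials_of_degree (carrier G) k. F (monomial_value G m)) =
           (\<Sum>j\<in>{1..k}. \<Sum>m\<in>monomials_of_degree (carrier G) (k - j).
              \<Sum>g\<in>carrier G. F (monomial_value G m \<otimes> g [^] j))"
proof -
  let ?C = "carrier G"
  let ?M = "monomials_of_degree ?C"
  have "int k * (\<Sum>m\<in>?M k. F (monomial_value G m)) =
      (\<Sum>m\<in>?M k. \<Sum>g\<in>?C. \<Sum>j\<in>{1..k}. if j \<le> Poly_Mapping.lookup m g then F (monomial_value G m) else 0)"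
    unfolding sum_distrib_left
  proof (rule sum.cong)
    fix m assume m: "m \<in> ?M k"
    then have deg: "(\<Sum>g\<in>?C. Poly_Mapping.lookup m g) = k"
      by (simp add: monomials_of_degree_def)
    have "(\<Sum>j\<in>{1..k}. if j \<le> Poly_Mapping.lookup m g then F (monomial_value G m) else 0) =
        int (Poly_Mapping.lookup m g) * F (monomial_value G m)" if g: "g \<in> ?C" for g
    proof -
      have "{j \<in> {1..k}. j \<le> Poly_Mapping.lookup m g} = {1..Poly_Mapping.lookup m g}"
        using member_le_sum[of g ?C "Poly_Mapping.lookup m"] g fin deg by auto
      then show ?thesis
        by (simp flip: sum.inter_filter)
    qed
    then show "int k * F (monomial_value G m) =
        (\<Sum>g\<in>?C. \<Sum>j\<in>{1..k}. if j \<le> Poly_Mapping.lookup m g then F (monomial_value G m) else 0)"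
      by (simp flip: sum_distrib_right of_nat_sum add: deg)
  qed simp
  also have "\<dots> = (\<Sum>g\<in>?C. \<Sum>j\<in>{1..k}. \<Sum>m\<in>?M k.
      if j \<le> Poly_Mapping.lookup m g then F (monomial_value G m) else 0)"
    by (subst sum.swap) (rule sum.cong[OF refl], rule sum.swap)
  also have "\<dots> = (\<Sum>g\<in>?C. \<Sum>j\<in>{1..k}. \<Sum>m\<in>?M (k - j). F (monomial_value G m \<otimes> g [^] j))"
  proof (rule sum.cong[OF refl], rule sum.cong[OF refl])
    fix g j assume g: "g \<in> ?C" and j: "j \<in> {1..k}"
    have "(\<Sum>m\<in>?M k. if j \<le> Poly_Mapping.lookup m g then F (monomial_value G m) else 0) =
        (\<Sum>m\<in>{m\<in>?M k. j \<le> Poly_Mapping.lookup m g}. F (monomial_value G m))"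
      by (rule sum.inter_filter[symmetric]) (rule finite_monomials_of_degree[OF fin])
    also have "\<dots> = (\<Sum>m\<in>?M (k - j). F (monomial_value G (m + power_monomial g j)))"
      using j by (intro sum.reindex_bij_betw[symmetric] bij_betw_add_power_monomial fin g) auto
    finally show "(\<Sum>m\<in>?M k. if j \<le> Poly_Mapping.lookup m g then F (monomial_value G m) else 0) =
        (\<Sum>m\<in>?M (k - j). F (monomial_value G m \<otimes> g [^] j))"
      using g by (simp add: monomial_value_add monomial_value_power fin)
  qed
  also have "\<dots> = (\<Sum>j\<in>{1..k}. \<Sum>m\<in>?M (k - j). \<Sum>g\<in>?C. F (monomial_value G m \<otimes> g [^] j))"
    by (subst sum.swap) (rule sum.cong[OF refl], rule sum.swap)
  finally show ?thesis .
qed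

text \<open>
  The hypothesis on \<open>F\<close> is what a character of order \<open>d\<close> satisfies. Under it the identity above becomes
  the recursion of \<open>inverse_power_coeff\<close>, so the sum is determined by its value at \<open>k = 0\<close>.
\<close>

lemma (in comm_group) sum_over_monomials:
  fixes F :: "'a \<Rightarrow> int"
  assumes fin: "finite (carrier G)" and d: "d > 0" and q: "q > 0" "order G = d * q"
    and F: "\<And>y j. y \<in> carrier G \<Longrightarrow> j \<ge> 1 \<Longrightarrow>
      (\<Sum>g\<in>carrier G. F (y \<otimes> g [^] j)) = (if d dvd j then int (order G) * F y else 0)"
  shows "(\<Sum>m\<in>monomials_of_degree (carrier G) k. F (monomial_value G m)) =
           F \<one> * int (inverse_power_coeff d q k)"
proof (induction k rule: less_induct)
  case (less k)
  let ?C = "carrier G"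
  let ?A = "\<lambda>k. \<Sum>m\<in>monomials_of_degree ?C k. F (monomial_value G m)"
  show ?case
  proof (cases "k = 0")
    case True
    then show ?thesis
      using fin by (simp add: monomials_of_degree_0 inverse_power_coeff_def)
  next
    case False
    have "int k * ?A k = (\<Sum>j\<in>{1..k}. \<Sum>m\<in>monomials_of_degree ?C (k - j).
        if d dvd j then int (order G) * F (monomial_value G m) else 0)"
      unfolding sum_over_monomials_rec[OF fin] using F by (intro sum.cong refl) auto
    also have "\<dots> = (\<Sum>j\<in>{1..k}. if d dvd j then int (order G) * ?A (k - j) else 0)"
      by (intro sum.cong) (auto simp: sum_distrib_left)
    also have "\<dots> = (\<Sum>j\<in>{1..k}. F \<one> * int (order G) *
        int (if d dvd j then inverse_power_coeff d q (k - j) else 0))"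
      using less.IH by (intro sum.cong) auto
    also have "\<dots> = F \<one> * int (order G *
        (\<Sum>j\<in>{1..k}. if d dvd j then inverse_power_coeff d q (k - j) else 0))"
      by (simp only: sum_distrib_left[symmetric] of_nat_sum of_nat_mult mult.assoc)
    also have "\<dots> = int k * (F \<one> * int (inverse_power_coeff d q k))"
      using inverse_power_coeff_rec[OF d q(1), of k] q(2) by (simp flip: of_nat_mult)
    finally show ?thesis
      using False by simp
  qed
qed

lemma gcd_prime_power_Suc:
  fixes p j :: nat
  assumes "prime p" and "\<not> p ^ Suc s dvd j"
  shows "gcd (p ^ Suc s) j = gcd (p ^ s) j"
proof -
  obtain i where i: "i \<le> Suc s" "gcd (p ^ Suc s) j = p ^ i"
    using divides_primepow_nat[OF assms(1)] gcd_dvd1 by blast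
  with assms(2) have "i \<noteq> Suc s"
    by (metis gcd_dvd2)
  with i have "p ^ i dvd p ^ s"
    by (simp add: le_imp_power_dvd)
  then have "gcd (p ^ Suc s) j dvd gcd (p ^ s) j"
    using i by (metis gcd_dvd2 gcd_greatest)
  moreover have "gcd (p ^ s) j dvd gcd (p ^ Suc s) j"
    by (intro gcd_mono le_imp_power_dvd) auto
  ultimately show ?thesis
    by (rule dvd_antisym)
qed

text \<open>
  The functions \<open>E t\<close> are the sums of all characters of order \<open>p\<^sup>t\<close>. That \<open>E t\<close> satisfies the averaging
  hypothesis with \<open>d = p\<^sup>t\<close> follows from \<open>sum_root_count\<close>: unless \<open>p\<^sup>t\<close> divides \<open>j\<close>, the numbers \<open>p\<^sup>t\<close> and
  \<open>p\<^bsup>t-1\<^esup>\<close> have the same gcd with \<open>j\<close>, and the two terms of \<open>E t\<close> cancel. The \<open>E t\<close> add up to the number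
  of solutions of \<open>h\<^bsup>p^N\<^esup> = y\<close>, which is \<open>p\<^sup>N\<close> for \<open>y = \<one>\<close> and \<open>0\<close> otherwise.
\<close>

lemma (in comm_group) card_monomials_of_value_one:
  assumes p: "prime p" and ord: "order G = p ^ N"
  shows "int (p ^ N) * int (card {m \<in> monomials_of_degree (carrier G) (p ^ N). monomial_value G m = \<one>}) =
     (\<Sum>t\<le>N. (int (root_count G (p ^ t) \<one>) - (if t = 0 then 0 else int (root_count G (p ^ (t - 1)) \<one>)))
            * int ((2 * p ^ (N - t) - 1) choose (p ^ (N - t))))"
proof -
  let ?M = "monomials_of_degree (carrier G) (p ^ N)"
  define E :: "nat \<Rightarrow> 'a \<Rightarrow> int" where
    "E t y = int (root_count G (p ^ t) y) - (if t = 0 then 0 else int (root_count G (p ^ (t - 1)) y))" for t y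
  have p0: "p > 0"
    using p by (simp add: prime_gt_0_nat)
  have fin: "finite (carrier G)"
    using ord p0 by (metis order_gt_0_iff_finite zero_less_power)
  have roots: "(\<Sum>g\<in>carrier G. int (root_count G (p ^ t) (y \<otimes> g [^] j))) =
      int (order G) * int (root_count G (gcd (p ^ t) j) y)" if "y \<in> carrier G" for t j y
    using sum_root_count[OF fin that, of "p ^ t" j] p0 by (simp flip: of_nat_sum of_nat_mult)
  have E: "(\<Sum>g\<in>carrier G. E t (y \<otimes> g [^] j)) = (if p ^ t dvd j then int (order G) * E t y else 0)"
    if y: "y \<in> carrier G" for t j y
  proof (cases t)
    case 0
    then show ?thesis
      using roots[OF y, of 0 j] by (simp add: E_def)
  next
    case (Suc s)
    have "(\<Sum>g\<in>carrier G. E t (y \<otimes> g [^] j)) =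
        int (order G) * (int (root_count G (gcd (p ^ t) j) y) - int (root_count G (gcd (p ^ s) j) y))"
      by (simp add: E_def Suc sum_subtractf roots[OF y, of "Suc s" j] roots[OF y, of s j]
          right_diff_distrib del: power_Suc)
    moreover have "gcd (p ^ t) j = p ^ t \<and> gcd (p ^ s) j = p ^ s" if "p ^ t dvd j"
      using that dvd_trans[OF le_imp_power_dvd[of s t p] that] by (simp add: Suc gcd_nat.absorb1)
    ultimately show ?thesis
      using gcd_prime_power_Suc[OF p, of s j] by (auto simp: E_def Suc)
  qed
  have "(\<Sum>m\<in>?M. E t (monomial_value G m)) = E t \<one> * int ((2 * p ^ (N - t) - 1) choose (p ^ (N - t)))"
    if t: "t \<le> N" for t
  proof -
    have N: "p ^ N = p ^ t * p ^ (N - t)"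
      using t by (simp flip: power_add)
    then have "inverse_power_coeff (p ^ t) (p ^ (N - t)) (p ^ N) = (2 * p ^ (N - t) - 1) choose (p ^ (N - t))"
      using p0 by (simp add: inverse_power_coeff_def mult_2)
    then show ?thesis
      using sum_over_monomials[OF fin, of "p ^ t" "p ^ (N - t)" "E t"] N E ord p0 by simp
  qed
  then have "(\<Sum>t\<le>N. E t \<one> * int ((2 * p ^ (N - t) - 1) choose (p ^ (N - t)))) =
      (\<Sum>t\<le>N. \<Sum>m\<in>?M. E t (monomial_value G m))"
    by simp
  also have "\<dots> = (\<Sum>m\<in>?M. \<Sum>t\<le>N. E t (monomial_value G m))"
    by (rule sum.swap)
  also have "\<dots> = (\<Sum>m\<in>?M. if monomial_value G m = \<one> then int (p ^ N) else 0)"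
  proof (rule sum.cong)
    fix m
    have "(\<Sum>t\<le>n. E t y) = int (root_count G (p ^ n) y)" for n y
      by (induction n) (simp_all add: E_def)
    moreover have "{h \<in> carrier G. h [^] p ^ N = y} = (if y = \<one> then carrier G else {})" for y
      using pow_order_eq_1 ord by auto
    ultimately show "(\<Sum>t\<le>N. E t (monomial_value G m)) =
        (if monomial_value G m = \<one> then int (p ^ N) else 0)"
      using ord by (simp add: root_count_def order_def)
  qed simp
  also have "\<dots> = int (p ^ N) * int (card {m \<in> ?M. monomial_value G m = \<one>})"
    using finite_monomials_of_degree[OF fin] by (simp flip: sum.inter_filter)
  finally show ?thesis
    by (simp add: E_def)
qed

section \<open>The first differing term decides\<close>

text \<open>
  With \<open>q = p r\<close>, the right side contains by Vandermonde's identity the summand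
  \<open>(q - 1 choose r) (q choose q - r)\<close>. Its first factor is at least \<open>2 r - 1 choose r\<close> because
  \<open>2 r \<le> q\<close>, and its second one at least \<open>q\<close>.
\<close>

lemma central_binomial_growth:
  fixes p r :: nat
  assumes "p \<ge> 2" and "r \<ge> 1"
  shows "p * r * ((2 * r - 1) choose r) \<le> (2 * (p * r) - 1) choose (p * r)"
proof -
  define q where "q = p * r"
  have q: "2 * r \<le> q"
    using assms by (simp add: q_def)
  have "q choose 1 \<le> q choose r"
    using q assms by (intro binomial_mono) auto
  then have "q \<le> q choose (q - r)"
    using q binomial_symmetric[of r q] by simp
  moreover have "(2 * r - 1) choose r \<le> (q - 1) choose r"
    using q by (intro binomial_right_mono) simp
  ultimately have "q * ((2 * r - 1) choose r) \<le> ((q - 1) choose r) * (q choose (q - r))"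
    by (metis mult.commute mult_le_mono)
  also have "\<dots> \<le> (\<Sum>k\<le>q. ((q - 1) choose k) * (q choose (q - k)))"
    using q by (intro member_le_sum) auto
  also have "\<dots> = (2 * q - 1) choose q"
    using q assms vandermonde[of "q - 1" q q] by (simp add: mult_2)
  finally show ?thesis
    by (simp add: q_def)
qed

lemma weighted_increments_sum_by_parts:
  fixes a c :: "nat \<Rightarrow> int"
  shows "(\<Sum>t\<le>n. (a t - (if t = 0 then 0 else a (t - 1))) * c t) =
           (\<Sum>t<n. a t * (c t - c (Suc t))) + a n * c n"
  by (induction n) (simp_all add: algebra_simps)

text \<open>
  Summation by parts turns the difference of the two sides into a sum over \<open>m \<le> t < N\<close> of
  \<open>a' t - a t\<close> against the nonnegative weights \<open>c t - c (t + 1)\<close>. The term \<open>t = m\<close> contributes at least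
  \<open>p\<^sup>m (c m - c (m + 1))\<close>. In each later term \<open>a' t - a t \<ge> p\<^sup>m - p\<^sup>N\<close>, so the later terms, whose weights telescope,
  lose at most \<open>(p\<^sup>N - p\<^sup>m) (c (m + 1) - 1)\<close>. Since \<open>p\<^sup>m c m \<ge> p\<^sup>N c (m + 1)\<close>, the total is at least
  \<open>p\<^sup>N - p\<^sup>m > 0\<close>.
\<close>

lemma weighted_increments_sum_less:
  fixes p N m :: nat and a a' c :: "nat \<Rightarrow> int"
  assumes p: "p \<ge> 2" and m: "m < N"
    and c_growth: "\<And>t. t < N \<Longrightarrow> int (p ^ (N - t)) * c (Suc t) \<le> c t" and c_last: "c N = 1"
    and below: "\<And>t. t < m \<Longrightarrow> a t = a' t" and at_m: "a m + int (p ^ m) \<le> a' m"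
    and lower: "\<And>t. m < t \<Longrightarrow> t < N \<Longrightarrow> int (p ^ m) \<le> a' t"
    and upper: "\<And>t. t < N \<Longrightarrow> a t \<le> int (p ^ N)" and last: "a N = a' N"
  shows "(\<Sum>t\<le>N. (a t - (if t = 0 then 0 else a (t - 1))) * c t) <
         (\<Sum>t\<le>N. (a' t - (if t = 0 then 0 else a' (t - 1))) * c t)"
proof -
  define \<Delta> where "\<Delta> t = c t - c (Suc t)" for t
  let ?u = "int (p ^ m)" and ?n = "int (p ^ N)"
  have c_pos: "1 \<le> c t" if "t \<le> N" for t
    using that
  proof (induction t rule: inc_induct)
    case base
    then show ?case by (simp add: c_last)
  next
    case (step t)
    have "1 * 1 \<le> int (p ^ (N - t)) * c (Suc t)"
      using step p by (intro mult_mono) auto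
    then show ?case
      using c_growth[of t] step by linarith
  qed
  have \<Delta>: "0 \<le> \<Delta> t" if "t < N" for t
  proof -
    have "1 * c (Suc t) \<le> int (p ^ (N - t)) * c (Suc t)"
      using that p c_pos[of "Suc t"] by (intro mult_right_mono) auto
    then show ?thesis
      using c_growth[OF that] by (simp add: \<Delta>_def)
  qed
  have un: "?u < ?n"
    using p m by simp
  have tail: "(\<Sum>t\<in>{Suc m..<N}. (?u - ?n) * \<Delta> t) = (?u - ?n) * (c (Suc m) - 1)"
    using m sum_Suc_diff'[of "Suc m" N "\<lambda>t. - c t"] c_last
    by (simp add: \<Delta>_def sum_distrib_left[symmetric] del: of_nat_power)
  have "?n * c (Suc m) \<le> ?u * c m"
  proof -
    have "?n = ?u * int (p ^ (N - m))"
      using m by (simp flip: of_nat_mult power_add)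
    then show ?thesis
      using mult_left_mono[OF c_growth[OF m], of ?u] by (simp add: mult.assoc)
  qed
  then have "0 < ?u * \<Delta> m + (?u - ?n) * (c (Suc m) - 1)"
    using un by (simp add: \<Delta>_def algebra_simps)
  also have "\<dots> = ?u * \<Delta> m + (\<Sum>t\<in>{Suc m..<N}. (?u - ?n) * \<Delta> t)"
    by (simp only: tail)
  also have "\<dots> \<le> (a' m - a m) * \<Delta> m + (\<Sum>t\<in>{Suc m..<N}. (a' t - a t) * \<Delta> t)"
  proof (intro add_mono sum_mono mult_right_mono)
    fix t assume "t \<in> {Suc m..<N}"
    then show "?u - ?n \<le> a' t - a t" "0 \<le> \<Delta> t"
      using lower[of t] upper[of t] \<Delta> by auto
  qed (use at_m m \<Delta> in auto)
  also have "\<dots> = (\<Sum>t\<in>{m..<N}. (a' t - a t) * \<Delta> t)"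
    using m by (simp add: sum.atLeast_Suc_lessThan)
  also have "\<dots> = (\<Sum>t<N. (a' t - a t) * \<Delta> t)"
    using below by (intro sum.mono_neutral_left) auto
  finally have "(\<Sum>t<N. a t * \<Delta> t) < (\<Sum>t<N. a' t * \<Delta> t)"
    by (simp add: left_diff_distrib sum_subtractf)
  then show ?thesis
    unfolding weighted_increments_sum_by_parts using last by (simp add: \<Delta>_def)
qed

section \<open>Abelian p-groups of partitions\<close>

lemma min_sum_le_column_sum: "min (sum_list ks) t \<le> column_sum ks t"
proof -
  have "min (\<Sum>i\<in>I. f i) t \<le> (\<Sum>i\<in>I. min (f i) t)" if "finite I" for I and f :: "nat \<Rightarrow> nat"
    using that by (induction I rule: finite_induct) (auto simp: min_def split: if_splits)
  then show ?thesis
    by (simp add: column_sum_def sum_list_sum_nth atLeast0LessThan)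
qed

lemma column_sum_le: "column_sum ks t \<le> sum_list ks"
  by (simp add: column_sum_def sum_list_sum_nth atLeast0LessThan sum_mono)

lemma column_sum_bounds:
  assumes "is_partition_of ks N" and "t \<le> N"
  shows "t \<le> column_sum ks t" and "column_sum ks t \<le> N"
  using assms min_sum_le_column_sum[of ks t] column_sum_le[of ks t]
  by (auto simp: is_partition_of_def)

lemma comm_group_abelian_p_group: "comm_group (abelian_p_group p ks)"
proof -
  interpret group "abelian_p_group p ks"
    by (rule group_abelian_p_group)
  show ?thesis
    by (rule group_comm_groupI) (auto simp: abelian_p_group_def add.commute)
qed

lemma pow_product_group:
  fixes x :: "'i \<Rightarrow> 'a" and n :: nat
  shows "x [^]\<^bsub>product_group I G\<^esub> n = (\<lambda>i\<in>I. x i [^]\<^bsub>G i\<^esub> n)"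
  by (induction n) (auto simp: fun_eq_iff)

text \<open>
  If \<open>t < k\<close>, the condition says that \<open>x\<close> is a multiple of \<open>p\<^bsup>k-t\<^esup>\<close>.
\<close>

lemma card_prime_power_torsion_cyclic:
  assumes "p > 0"
  shows "card {x \<in> {0..<int (p ^ k)}. int (p ^ t) * x mod int (p ^ k) = 0} = p ^ min k t"
proof (cases "k \<le> t")
  case True
  then have "int (p ^ k) dvd int (p ^ t) * x" for x
    by (simp add: le_imp_power_dvd)
  then have "{x \<in> {0..<int (p ^ k)}. int (p ^ t) * x mod int (p ^ k) = 0} = {0..<int (p ^ k)}"
    by (auto simp: dvd_eq_mod_eq_0)
  then show ?thesis
    using True by (simp add: nat_power_eq)
next
  case False
  define c where "c = int (p ^ (k - t))"
  have c: "c > 0" "int (p ^ k) = int (p ^ t) * c"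
    using False assms by (auto simp: c_def simp flip: power_add)
  have pt: "int (p ^ t) > 0"
    using assms by simp
  have "{x \<in> {0..<int (p ^ k)}. int (p ^ t) * x mod int (p ^ k) = 0} = (*) c ` {0..<int (p ^ t)}"
  proof (intro equalityI subsetI)
    fix x assume x: "x \<in> {x \<in> {0..<int (p ^ k)}. int (p ^ t) * x mod int (p ^ k) = 0}"
    then have "int (p ^ t) * c dvd int (p ^ t) * x"
      unfolding c(2)[symmetric] by auto
    then have "c dvd x"
      using pt by (metis dvd_mult_cancel_left less_irrefl)
    then obtain y where y: "x = c * y" by blast
    then have "0 \<le> y" "y < int (p ^ t)"
      using x c(1) unfolding c(2) by (auto simp: zero_le_mult_iff mult.commute[of _ c])
    then show "x \<in> (*) c ` {0..<int (p ^ t)}"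
      using y by auto
  next
    fix x assume "x \<in> (*) c ` {0..<int (p ^ t)}"
    then show "x \<in> {x \<in> {0..<int (p ^ k)}. int (p ^ t) * x mod int (p ^ k) = 0}"
      unfolding c(2) using c(1) by (auto simp: mult.commute[of _ c] mult.left_commute[of _ c])
  qed
  moreover have "inj_on ((*) c) {0..<int (p ^ t)}"
    using c(1) by (auto simp: inj_on_def)
  ultimately show ?thesis
    using False by (simp add: card_image nat_power_eq)
qed

lemma root_count_abelian_p_group:
  assumes p: "p > 0"
  shows "root_count (abelian_p_group p ks) (p ^ t) \<one>\<^bsub>abelian_p_group p ks\<^esub> = p ^ column_sum ks t"
proof -
  let ?G = "abelian_p_group p ks" and ?I = "{..<length ks}"
  have "h [^]\<^bsub>?G\<^esub> (p ^ t) = \<one>\<^bsub>?G\<^esub> \<longleftrightarrow>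
      (\<forall>i\<in>?I. int (p ^ t) * h i mod int (p ^ (ks ! i)) = 0)" for h
  proof -
    have "h [^]\<^bsub>?G\<^esub> (p ^ t) = (\<lambda>i\<in>?I. int (p ^ t) * h i mod int (p ^ (ks ! i)))"
      "\<one>\<^bsub>?G\<^esub> = (\<lambda>i\<in>?I. 0)"
      by (simp_all only: abelian_p_group_def pow_product_group pow_integer_mod_group
          one_product_group one_integer_mod_group)
    moreover have "restrict f ?I = (\<lambda>i\<in>?I. 0) \<longleftrightarrow> (\<forall>i\<in>?I. f i = 0)" for f :: "nat \<Rightarrow> int"
      by (metis restrict_apply' restrict_ext)
    ultimately show ?thesis
      by (simp only:)
  qed
  moreover have "carrier ?G = (\<Pi>\<^sub>E i\<in>?I. {0..<int (p ^ (ks ! i))})"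
    using p by (simp add: abelian_p_group_def carrier_integer_mod_group)
  ultimately have "{h \<in> carrier ?G. h [^]\<^bsub>?G\<^esub> (p ^ t) = \<one>\<^bsub>?G\<^esub>} =
      (\<Pi>\<^sub>E i\<in>?I. {x \<in> {0..<int (p ^ (ks ! i))}. int (p ^ t) * x mod int (p ^ (ks ! i)) = 0})"
    by (simp only: PiE_iff set_eq_iff mem_Collect_eq) blast
  then have "root_count ?G (p ^ t) \<one>\<^bsub>?G\<^esub> =
      (\<Prod>i\<in>?I. p ^ min (ks ! i) t)"
    unfolding root_count_def by (simp only: card_PiE finite_lessThan card_prime_power_torsion_cyclic[OF p])
  then show ?thesis
    by (simp add: column_sum_def power_sum)
qed

lemma num_monomials_group_permanent:
  assumes p: "prime p" and ks: "is_partition_of ks N"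
  shows "int (p ^ N) * int (num_monomials (group_permanent (abelian_p_group p ks))) =
     (\<Sum>t\<le>N. (int (p ^ column_sum ks t) - (if t = 0 then 0 else int (p ^ column_sum ks (t - 1))))
            * int ((2 * p ^ (N - t) - 1) choose (p ^ (N - t))))"
proof -
  interpret comm_group "abelian_p_group p ks"
    by (rule comm_group_abelian_p_group)
  have p0: "p > 0"
    using p by (simp add: prime_gt_0_nat)
  have ord: "order (abelian_p_group p ks) = p ^ N"
    using order_abelian_p_group[OF p0 ks] .
  have fin: "finite (carrier (abelian_p_group p ks))"
    using ord p0 by (metis order_gt_0_iff_finite zero_less_power)
  show ?thesis
    using card_monomials_of_value_one[OF p ord] keys_group_permanent[OF fin]
    by (simp only: num_monomials_def ord root_count_abelian_p_group[OF p0])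
qed

theorem theorem1p2:
  fixes p N :: nat and lam mu :: "nat list"
  assumes "prime p"
    and "N > 0"
    and "is_partition_of lam N"
    and "is_partition_of mu N"
    and "\<exists>m\<in>{1..N - 1}. (\<forall>t\<in>{1..m - 1}. column_sum lam t = column_sum mu t) \<and>
           column_sum lam m < column_sum mu m"
  shows "num_monomials (group_permanent (abelian_p_group p lam))
       < num_monomials (group_permanent (abelian_p_group p mu))"
proof -
  obtain m where m: "1 \<le> m" "m < N" "column_sum lam m < column_sum mu m"
    and agree: "\<And>t. 1 \<le> t \<Longrightarrow> t < m \<Longrightarrow> column_sum lam t = column_sum mu t"
    using assms(2,5) by fastforce
  have p: "p \<ge> 2"
    using assms(1) by (simp add: prime_ge_2_nat)
  have lam: "t \<le> column_sum lam t \<and> column_sum lam t \<le> N"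
    and mu: "t \<le> column_sum mu t \<and> column_sum mu t \<le> N" if "t \<le> N" for t
    using column_sum_bounds that assms(3,4) by auto
  define c where "c t = int ((2 * p ^ (N - t) - 1) choose (p ^ (N - t)))" for t
  have "int (p ^ N) * int (num_monomials (group_permanent (abelian_p_group p lam))) <
      int (p ^ N) * int (num_monomials (group_permanent (abelian_p_group p mu)))"
    unfolding num_monomials_group_permanent[OF assms(1,3)] num_monomials_group_permanent[OF assms(1,4)]
    unfolding c_def[symmetric]
  proof (rule weighted_increments_sum_less[OF p m(2)])
    fix t assume "t < N"
    then have "p ^ (N - t) = p * p ^ (N - Suc t)"
      by (simp add: Suc_diff_Suc flip: power_Suc)
    then show "int (p ^ (N - t)) * c (Suc t) \<le> c t"
      unfolding c_def using central_binomial_growth[OF p, of "p ^ (N - Suc t)"] p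
      by (simp only: of_nat_mult[symmetric] of_nat_le_iff) (simp add: Suc_le_eq)
  next
    show "c N = 1" by (simp add: c_def)
  next
    fix t assume "t < m"
    then show "int (p ^ column_sum lam t) = int (p ^ column_sum mu t)"
      using agree[of t] by (cases "t = 0") auto
  next
    have "p ^ column_sum lam m + p ^ m \<le> 2 * p ^ column_sum lam m"
      using lam[of m] m p by (simp add: power_increasing)
    also have "\<dots> \<le> p ^ Suc (column_sum lam m)"
      using p by simp
    also have "\<dots> \<le> p ^ column_sum mu m"
      using m p by (intro power_increasing) auto
    finally show "int (p ^ column_sum lam m) + int (p ^ m) \<le> int (p ^ column_sum mu m)"
      by (simp only: of_nat_add[symmetric] of_nat_le_iff)
  next
    fix t assume "m < t" "t < N"
    then have "m \<le> column_sum mu t"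
      using mu[of t] by simp
    then show "int (p ^ m) \<le> int (p ^ column_sum mu t)"
      using p by (simp add: power_increasing)
  next
    fix t assume "t < N"
    then show "int (p ^ column_sum lam t) \<le> int (p ^ N)"
      using lam[of t] p by (simp add: power_increasing)
  next
    show "int (p ^ column_sum lam N) = int (p ^ column_sum mu N)"
      using lam[of N] mu[of N] by (metis le_antisym order_refl)
  qed
  then show ?thesis
    using p by simp
qed

end
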